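(* Let $G$ be a finite simple connected non-complete graph. Then $\gamma(G)\le \mathrm{v}_\emptyset(J_G)$.
   Context: A dominating set of a graph $G$ is a set $D\subseteq V(G)$ such that every vertex not in $D$ has a neighbour in $D$; the domination number $\gamma(G)$ is the minimum cardinality of a dominating set. Let $K$ be a field and $V(G)=[n]$. Put $S=K[x_1,\dots,x_n,y_1,\dots,y_n]$ (standard grading), $f_{ij}=x_iy_j-x_jy_i$, and $J_G=\langle f_{ij}\mid\{i,j\}\in E(G), i<j\rangle$ (binomial edge ideal). $P_\emptyset(G)$ is the ideal of $S$ generated by all $f_{ij}$ with $i<j$ in the same connected component of $G$ (for connected $G$: all $f_{ij}$, $1\le i<j\le n$); it is an associated prime of $J_G$. Define $\mathrm{v}_\emptyset(J_G)=\min\{d\ge 0\mid\exists f\in S_d\text{ with }(J_G:f)=P_\emptyset(G)\}$. *)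

theory Defs
  imports Complex_Main "HOL-Library.Poly_Mapping"
begin

section \<open>Finite simple graphs\<close>

text \<open>The vertex set is the universe of a finite, linearly ordered type \<open>'v\<close>, which plays the
  role of \<open>{1, ..., n}\<close> with \<open>n = CARD('v)\<close>; a graph is given by its set of edges.\<close>

definition simple_graph :: "'v::finite set set \<Rightarrow> bool" where
  "simple_graph E \<longleftrightarrow> (\<forall>e\<in>E. card e = 2)"

definition same_component :: "'v set set \<Rightarrow> 'v \<Rightarrow> 'v \<Rightarrow> bool" where
  "same_component E = (\<lambda>u v. {u, v} \<in> E)\<^sup>*\<^sup>*"

definition connected_graph :: "'v set set \<Rightarrow> bool" where
  "connected_graph E \<longleftrightarrow> (\<forall>u v. same_component E u v)"

definition complete_graph :: "'v set set \<Rightarrow> bool" where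
  "complete_graph E \<longleftrightarrow> (\<forall>u v. u \<noteq> v \<longrightarrow> {u, v} \<in> E)"

definition dominating_set :: "'v set set \<Rightarrow> 'v set \<Rightarrow> bool" where
  "dominating_set E D \<longleftrightarrow> (\<forall>v. v \<notin> D \<longrightarrow> (\<exists>u\<in>D. {u, v} \<in> E))"

definition domination_number :: "'v::finite set set \<Rightarrow> nat" where
  "domination_number E = Min (card ` {D. dominating_set E D})"


section \<open>The polynomial ring \<open>S\<close> and its ideals\<close>

datatype 'v variable = X 'v | Y 'v

text \<open>Polynomials are finitely supported maps from monomials (exponent vectors) to coefficients;
  \<open>S\<close> is the whole type, with exactly the variables \<open>X v\<close> and \<open>Y v\<close> for \<open>v :: 'v\<close>.\<close>

type_synonym 'v monomial = "'v variable \<Rightarrow>\<^sub>0 nat"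
type_synonym ('v, 'k) S = "'v monomial \<Rightarrow>\<^sub>0 'k"

definition var :: "'v variable \<Rightarrow> ('v, 'k::comm_ring_1) S" where
  "var z = Poly_Mapping.single (Poly_Mapping.single z 1) 1"

definition monomial_degree :: "'v monomial \<Rightarrow> nat" where
  "monomial_degree m = (\<Sum>z\<in>Poly_Mapping.keys m. Poly_Mapping.lookup m z)"

text \<open>The graded component \<open>S_d\<close>; it contains \<open>0\<close> for every \<open>d\<close>.\<close>

definition homogeneous_part :: "nat \<Rightarrow> ('v, 'k::comm_ring_1) S set" where
  "homogeneous_part d = {f. \<forall>m\<in>Poly_Mapping.keys f. monomial_degree m = d}"

lemma module_times: "module ((*) :: 'a::comm_ring_1 \<Rightarrow> 'a \<Rightarrow> 'a)"
  by (rule module.intro) (simp_all add: algebra_simps)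

text \<open>The ideal generated by a set is the submodule it spans in the ring as a module over
  itself.\<close>

definition ideal_generated :: "'a::comm_ring_1 set \<Rightarrow> 'a set" where
  "ideal_generated B = module.span (*) B"

definition colon :: "'a::comm_ring_1 set \<Rightarrow> 'a \<Rightarrow> 'a set" where
  "colon I f = {g. g * f \<in> I}"


section \<open>Binomial edge ideals\<close>

definition edge_binomial :: "'v \<Rightarrow> 'v \<Rightarrow> ('v, 'k::comm_ring_1) S" where
  "edge_binomial i j = var (X i) * var (Y j) - var (X j) * var (Y i)"

definition binomial_edge_ideal :: "'v::linorder set set \<Rightarrow> ('v, 'k::comm_ring_1) S set" where
  "binomial_edge_ideal E = ideal_generated {edge_binomial i j | i j. i < j \<and> {i, j} \<in> E}"

definition P_empty :: "'v::linorder set set \<Rightarrow> ('v, 'k::comm_ring_1) S set" where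
  "P_empty E = ideal_generated {edge_binomial i j | i j. i < j \<and> same_component E i j}"

text \<open>The type argument fixes the coefficient field.\<close>

definition v_empty :: "'k::field itself \<Rightarrow> 'v::linorder set set \<Rightarrow> nat" where
  "v_empty _ E = (LEAST d. \<exists>f \<in> homogeneous_part d.
     colon (binomial_edge_ideal E) f = (P_empty E :: ('v, 'k) S set))"

end

theory Submission
  imports Defs
begin

text \<open>Write \<open>J\<close> for the binomial edge ideal and \<open>P\<close> for \<open>P_empty E\<close>; since the graph is
  connected, \<open>P\<close> contains all \<open>2 \<times> 2\<close> minors of the generic matrix with rows \<open>x\<close> and \<open>y\<close>. If
  \<open>f\<close> is homogeneous of degree \<open>d\<close> with \<open>J : f = P\<close>, then the vertices occurring in a suitable
  monomial of \<open>f\<close> form a dominating set; there are at most \<open>d\<close> of them.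

  Both ideals are handled by linear functionals that add up the coefficients of a polynomial over
  a set of monomials. Modulo \<open>P\<close>, a product \<open>x\<^sub>i y\<^sub>j\<close> may be replaced by \<open>x\<^sub>j y\<^sub>i\<close>, and two
  monomials can be turned into each other by such swaps exactly when they have the same degree at
  every vertex and the same total degree in the \<open>x\<close>-variables. So \<open>P\<close> consists of the polynomials
  whose coefficients add up to zero over each such swap class (\<open>P_empty_iff_coeff_sum\<close>). Hence
  \<open>P\<close> contains no monomial, and monomials can be cancelled modulo \<open>P\<close>.

  The identity \<open>x\<^sub>j f\<^sub>i\<^sub>k = x\<^sub>i f\<^sub>j\<^sub>k + x\<^sub>k f\<^sub>i\<^sub>j\<close>, used along paths, yields a single monomial \<open>w\<close>
  that multiplies every minor into \<open>J\<close>, and cancellation gives \<open>J : w = P\<close>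
  (\<open>exists_monomial_colon_eq_P_empty\<close>). This shows that the minimum defining \<open>v_empty\<close> is
  attained. It also shows that any \<open>f\<close> with \<open>J : f = P\<close> lies outside \<open>P\<close>: otherwise \<open>w f \<in> J\<close>,
  that is, \<open>w \<in> J : f = P\<close>. So the coefficients of \<open>f\<close> over the swap class of some monomial \<open>m\<close>
  do not add up to zero.

  Let \<open>D\<close> be the set of vertices of positive degree in \<open>m\<close> and suppose that \<open>D\<close> does not dominate
  \<open>v\<close>. Then any \<open>j \<in> D\<close> differs from \<open>v\<close> and is not adjacent to it. If \<open>D\<close> is empty, no vertex
  is dominated, and \<open>v\<close> and \<open>j\<close> can be the ends of a missing edge, as the graph is not complete.
  Consider the monomials that have the vertex degrees and the \<open>x\<close>-degree of \<open>m x\<^sub>v y\<^sub>j\<close> and are not divisible by \<open>y\<^sub>v\<close>. They involve no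
  neighbour of \<open>v\<close>, so adding up coefficients over them annihilates \<open>J\<close>
  (\<open>coeff_sum_binomial_edge_ideal_zero\<close>). But this functional sends \<open>f f\<^sub>v\<^sub>j\<close>, which lies in \<open>J\<close>,
  to the nonzero coefficient sum of \<open>f\<close> over the swap class of \<open>m\<close>. So \<open>D\<close> is dominating
  (\<open>support_dominating\<close>).\<close>

section \<open>Ideals and coefficient sums\<close>

lemma ideal_generated_base: "b \<in> B \<Longrightarrow> b \<in> ideal_generated B"
  unfolding ideal_generated_def by (rule module.span_base[OF module_times])

lemma ideal_generated_zero: "0 \<in> ideal_generated B"
  unfolding ideal_generated_def by (rule module.span_zero[OF module_times])

lemma ideal_generated_add:
  "a \<in> ideal_generated B \<Longrightarrow> b \<in> ideal_generated B \<Longrightarrow> a + b \<in> ideal_generated B"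
  unfolding ideal_generated_def by (rule module.span_add[OF module_times])

lemma ideal_generated_uminus: "a \<in> ideal_generated B \<Longrightarrow> - a \<in> ideal_generated B"
  unfolding ideal_generated_def by (rule module.span_neg[OF module_times])

lemma ideal_generated_mult: "a \<in> ideal_generated B \<Longrightarrow> r * a \<in> ideal_generated B"
  unfolding ideal_generated_def by (rule module.span_scale[OF module_times])

lemma ideal_generated_sum:
  "(\<And>x. x \<in> A \<Longrightarrow> f x \<in> ideal_generated B) \<Longrightarrow> sum f A \<in> ideal_generated B"
  unfolding ideal_generated_def by (rule module.span_sum[OF module_times])

lemma ideal_generated_induct [consumes 1, case_names zero step]:
  assumes "a \<in> ideal_generated B" and "h 0"
    and "\<And>c x y. x \<in> B \<Longrightarrow> h y \<Longrightarrow> h (c * x + y)"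
  shows "h a"
  using module.span_induct_alt[OF module_times, of a B h] assms
  unfolding ideal_generated_def by blast

lemma ideal_generated_mono: "B \<subseteq> C \<Longrightarrow> ideal_generated B \<subseteq> ideal_generated C"
  unfolding ideal_generated_def by (rule module.span_mono[OF module_times])

lemma poly_mapping_expand:
  "g = (\<Sum>m\<in>Poly_Mapping.keys g. Poly_Mapping.single m (Poly_Mapping.lookup g m))"
  by (rule poly_mapping_eqI) (simp add: lookup_sum lookup_single when_def in_keys_iff)

definition coeff_sum :: "'a set \<Rightarrow> ('a \<Rightarrow>\<^sub>0 'k::comm_ring_1) \<Rightarrow> 'k" where
  "coeff_sum A g = (\<Sum>m\<in>Poly_Mapping.keys g. if m \<in> A then Poly_Mapping.lookup g m else 0)"

lemma coeff_sum_superset: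
  assumes "finite F" "Poly_Mapping.keys g \<subseteq> F"
  shows "coeff_sum A g = (\<Sum>m\<in>F. if m \<in> A then Poly_Mapping.lookup g m else 0)"
  unfolding coeff_sum_def
  by (rule sum.mono_neutral_left) (use assms in \<open>auto simp: in_keys_iff\<close>)

lemma coeff_sum_zero [simp]: "coeff_sum A 0 = 0"
  by (simp add: coeff_sum_def)

lemma coeff_sum_single [simp]:
  "coeff_sum A (Poly_Mapping.single m c) = (if m \<in> A then c else 0)"
  by (simp add: coeff_sum_def)

lemma coeff_sum_add:
  fixes f g :: "'a \<Rightarrow>\<^sub>0 'k::comm_ring_1"
  shows "coeff_sum A (f + g) = coeff_sum A f + coeff_sum A g"
proof -
  let ?F = "Poly_Mapping.keys f \<union> Poly_Mapping.keys g"
  have "coeff_sum A h = (\<Sum>m\<in>?F. if m \<in> A then Poly_Mapping.lookup h m else 0)"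
    if "Poly_Mapping.keys h \<subseteq> ?F" for h :: "'a \<Rightarrow>\<^sub>0 'k"
    by (rule coeff_sum_superset) (use that in auto)
  moreover have "Poly_Mapping.keys (f + g) \<subseteq> ?F"
    by (rule Poly_Mapping.keys_add)
  ultimately have "coeff_sum A (f + g) =
      (\<Sum>m\<in>?F. if m \<in> A then Poly_Mapping.lookup (f + g) m else 0)"
    "coeff_sum A f = (\<Sum>m\<in>?F. if m \<in> A then Poly_Mapping.lookup f m else 0)"
    "coeff_sum A g = (\<Sum>m\<in>?F. if m \<in> A then Poly_Mapping.lookup g m else 0)"
    by simp_all
  then show ?thesis
    by (simp only: sum.distrib[symmetric]) (intro sum.cong, auto simp: lookup_add)
qed

lemma coeff_sum_uminus: "coeff_sum A (- f) = - coeff_sum A f"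
  using coeff_sum_add[of A f "- f"] by (simp add: eq_neg_iff_add_eq_0 add.commute)

lemma coeff_sum_diff: "coeff_sum A (f - g) = coeff_sum A f - coeff_sum A g"
  using coeff_sum_add[of A f "- g"] by (simp add: coeff_sum_uminus)

lemma coeff_sum_sum: "coeff_sum A (sum f I) = (\<Sum>i\<in>I. coeff_sum A (f i))"
  by (induction I rule: infinite_finite_induct) (auto simp: coeff_sum_add)

lemma coeff_sum_single_times:
  fixes g :: "'a::comm_monoid_add \<Rightarrow>\<^sub>0 'k::comm_ring_1"
  shows "coeff_sum A (Poly_Mapping.single m c * g) = c * coeff_sum {n. m + n \<in> A} g"
proof -
  have "coeff_sum A (Poly_Mapping.single m c * g) =
      coeff_sum A (\<Sum>n\<in>Poly_Mapping.keys g. Poly_Mapping.single (m + n) (c * Poly_Mapping.lookup g n))"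
    by (subst poly_mapping_expand[of g]) (simp only: sum_distrib_left mult_single)
  also have "\<dots> = c * coeff_sum {n. m + n \<in> A} g"
    unfolding coeff_sum_sum coeff_sum_single coeff_sum_def[of _ g] sum_distrib_left
    by (intro sum.cong) auto
  finally show ?thesis .
qed

text \<open>A functional \<open>coeff_sum A\<close> is linear over the coefficients only. An ideal is spanned
  over the coefficients by the monomial multiples of its generators, so these are all that has to
  be tested.\<close>

lemma coeff_sum_ideal_generated:
  fixes g :: "'a::comm_monoid_add \<Rightarrow>\<^sub>0 'k::comm_ring_1"
  assumes "g \<in> ideal_generated B"
    and B: "\<And>b n. b \<in> B \<Longrightarrow> coeff_sum A (Poly_Mapping.single n 1 * b) = 0"
  shows "coeff_sum A g = 0"
  using assms(1)
proof (induction rule: ideal_generated_induct)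
  case (step r b y)
  have B': "coeff_sum A (Poly_Mapping.single n c * b) = 0" for n c
    using B[OF step(1), of n] by (simp add: coeff_sum_single_times)
  have "coeff_sum A (r * b) =
      (\<Sum>n\<in>Poly_Mapping.keys r. coeff_sum A (Poly_Mapping.single n (Poly_Mapping.lookup r n) * b))"
    by (subst (1) poly_mapping_expand[of r]) (simp only: sum_distrib_right coeff_sum_sum)
  with step(2) show ?case
    by (simp add: coeff_sum_add B')
qed simp


section \<open>Degrees of monomials\<close>

definition vertex_degree :: "'v monomial \<Rightarrow> 'v \<Rightarrow> nat" where
  "vertex_degree m v = Poly_Mapping.lookup m (X v) + Poly_Mapping.lookup m (Y v)"

definition x_degree :: "'v::finite monomial \<Rightarrow> nat" where
  "x_degree m = (\<Sum>v\<in>UNIV. Poly_Mapping.lookup m (X v))"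

abbreviation xm :: "'v \<Rightarrow> 'v monomial" where "xm v \<equiv> Poly_Mapping.single (X v) (Suc 0)"
abbreviation ym :: "'v \<Rightarrow> 'v monomial" where "ym v \<equiv> Poly_Mapping.single (Y v) (Suc 0)"

lemma vertex_degree_add: "vertex_degree (m + n) v = vertex_degree m v + vertex_degree n v"
  by (simp add: vertex_degree_def lookup_add)

lemma vertex_degree_xm: "vertex_degree (xm u) v = (if u = v then 1 else 0)"
  by (auto simp: vertex_degree_def lookup_single when_def)

lemma vertex_degree_ym: "vertex_degree (ym u) v = (if u = v then 1 else 0)"
  by (auto simp: vertex_degree_def lookup_single when_def)

lemma x_degree_add: "x_degree (m + n) = x_degree m + x_degree n"
  by (simp add: x_degree_def lookup_add sum.distrib)

lemma x_degree_xm: "x_degree (xm u) = 1"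
  by (simp add: x_degree_def lookup_single when_def)

lemma x_degree_ym: "x_degree (ym u) = 0"
  by (simp add: x_degree_def lookup_single when_def)

lemmas degree_simps =
  vertex_degree_add vertex_degree_xm vertex_degree_ym x_degree_add x_degree_xm x_degree_ym

lemma degrees_swap:
  fixes n :: "'v::finite monomial"
  shows "vertex_degree (n + (xm i + ym j)) = vertex_degree (n + (xm j + ym i))"
    and "x_degree (n + (xm i + ym j)) = x_degree (n + (xm j + ym i))"
  by (rule ext) (simp_all add: degree_simps)

lemma monomial_degree_eq_sum_vertex_degree:
  fixes m :: "'v::finite monomial"
  shows "monomial_degree m = (\<Sum>v\<in>UNIV. vertex_degree m v)"
proof -
  have U: "(UNIV :: 'v variable set) = X ` UNIV \<union> Y ` UNIV"
    by (metis UNIV_eq_I UnI1 UnI2 rangeI variable.exhaust)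
  have fin: "finite (UNIV :: 'v variable set)"
    unfolding U by simp
  have "monomial_degree m = (\<Sum>z\<in>UNIV. Poly_Mapping.lookup m z)"
    unfolding monomial_degree_def
    by (rule sum.mono_neutral_left) (use fin in \<open>auto simp: in_keys_iff\<close>)
  also have "\<dots> = (\<Sum>z\<in>range X. Poly_Mapping.lookup m z) + (\<Sum>z\<in>range Y. Poly_Mapping.lookup m z)"
    unfolding U by (rule sum.union_disjoint) auto
  also have "\<dots> = (\<Sum>v\<in>UNIV. vertex_degree m v)"
    by (simp add: sum.reindex inj_def vertex_degree_def sum.distrib)
  finally show ?thesis .
qed

lemma card_support_le_monomial_degree:
  fixes m :: "'v::finite monomial"
  shows "card {v. vertex_degree m v \<noteq> 0} \<le> monomial_degree m"
proof -
  have "card {v. vertex_degree m v \<noteq> 0} = (\<Sum>v\<in>{v. vertex_degree m v \<noteq> 0}. 1)"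
    by simp
  also have "\<dots> \<le> (\<Sum>v\<in>{v. vertex_degree m v \<noteq> 0}. vertex_degree m v)"
    by (rule sum_mono) simp
  also have "\<dots> \<le> (\<Sum>v\<in>UNIV. vertex_degree m v)"
    by (rule sum_mono2) auto
  finally show ?thesis
    by (simp add: monomial_degree_eq_sum_vertex_degree)
qed

lemma edge_binomial_eq:
  "edge_binomial i j =
    Poly_Mapping.single (xm i + ym j) 1 - Poly_Mapping.single (xm j + ym i) 1"
  by (simp add: edge_binomial_def var_def mult_single)

lemma coeff_sum_edge_binomial:
  "coeff_sum A (Poly_Mapping.single n 1 * edge_binomial i j) =
    (if n + (xm i + ym j) \<in> A then 1 else 0) - (if n + (xm j + ym i) \<in> A then 1 else 0)"
  by (simp add: edge_binomial_eq right_diff_distrib mult_single coeff_sum_diff)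

lemma edge_binomial_swap: "edge_binomial j i = - edge_binomial i j"
  by (simp add: edge_binomial_def)

lemma edge_binomial_same: "edge_binomial i i = 0"
  by (simp add: edge_binomial_def)


section \<open>The ideal of all maximal minors\<close>

text \<open>The swap classes are the fibres of the monomial map that sends \<open>X v\<close> to \<open>s t\<^sub>v\<close> and \<open>Y v\<close>
  to \<open>u t\<^sub>v\<close>, the parametrisation of the matrices of rank at most one.\<close>

definition swap_class :: "'v::finite monomial \<Rightarrow> 'v monomial set" where
  "swap_class m = {n. vertex_degree n = vertex_degree m \<and> x_degree n = x_degree m}"

lemma swap_class_eq_iff: "swap_class m = swap_class n \<longleftrightarrow> m \<in> swap_class n"
  by (auto simp: swap_class_def)

lemma swap_class_add_iff: "m + n \<in> swap_class (m + k) \<longleftrightarrow> n \<in> swap_class k"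
  by (auto simp: swap_class_def vertex_degree_add x_degree_add fun_eq_iff)

text \<open>As long as \<open>m \<noteq> n\<close>, equality of the \<open>x\<close>-degrees gives vertices \<open>i\<close> and \<open>j\<close> at which
  \<open>m\<close> has too many and too few factors \<open>x\<close> compared with \<open>n\<close>. At \<open>j\<close> the monomial \<open>m\<close> then has a
  factor \<open>y\<close> to spare, because the vertex degrees agree. Swapping \<open>x\<^sub>i y\<^sub>j\<close> for \<open>x\<^sub>j y\<^sub>i\<close> stays in the
  same class modulo the ideal and reduces the total excess of \<open>m\<close> over \<open>n\<close> in the
  \<open>x\<close>-variables.\<close>

lemma swap_class_cong_ideal:
  fixes m n :: "'v::finite monomial" and B :: "('v, 'k::comm_ring_1) S set"
  assumes B: "\<And>i j. edge_binomial i j \<in> ideal_generated B"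
    and "m \<in> swap_class n"
  shows "Poly_Mapping.single m 1 - Poly_Mapping.single n 1 \<in> ideal_generated B"
  using assms(2)
proof (induction "\<Sum>v\<in>UNIV. Poly_Mapping.lookup m (X v) - Poly_Mapping.lookup n (X v)"
    arbitrary: m rule: less_induct)
  case less
  have vd: "Poly_Mapping.lookup m (X v) + Poly_Mapping.lookup m (Y v) =
      Poly_Mapping.lookup n (X v) + Poly_Mapping.lookup n (Y v)" for v
    using less.prems by (auto simp: swap_class_def vertex_degree_def fun_eq_iff)
  have xd: "(\<Sum>v\<in>UNIV. Poly_Mapping.lookup m (X v)) = (\<Sum>v\<in>UNIV. Poly_Mapping.lookup n (X v))"
    using less.prems by (auto simp: swap_class_def x_degree_def)
  show ?case
  proof (cases "\<exists>i. Poly_Mapping.lookup n (X i) < Poly_Mapping.lookup m (X i)")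
    case False
    then have le: "Poly_Mapping.lookup m (X v) \<le> Poly_Mapping.lookup n (X v)" for v
      by (simp add: not_less)
    have eqX: "Poly_Mapping.lookup m (X v) = Poly_Mapping.lookup n (X v)" for v
    proof (rule ccontr)
      assume "Poly_Mapping.lookup m (X v) \<noteq> Poly_Mapping.lookup n (X v)"
      then have "(\<Sum>v\<in>UNIV. Poly_Mapping.lookup m (X v)) < (\<Sum>v\<in>UNIV. Poly_Mapping.lookup n (X v))"
        by (intro sum_strict_mono_ex1) (use le in \<open>auto intro!: exI[of _ v] simp: order.strict_iff_order\<close>)
      with xd show False by simp
    qed
    with vd have "Poly_Mapping.lookup m (Y v) = Poly_Mapping.lookup n (Y v)" for v
      by (metis add_left_cancel)
    with eqX have "m = n"
      by (intro poly_mapping_eqI) (metis variable.exhaust)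
    then show ?thesis
      by (simp add: ideal_generated_zero)
  next
    case True
    then obtain i where i: "Poly_Mapping.lookup n (X i) < Poly_Mapping.lookup m (X i)" ..
    have "\<exists>j. Poly_Mapping.lookup m (X j) < Poly_Mapping.lookup n (X j)"
    proof (rule ccontr)
      assume "\<not> ?thesis"
      then have "(\<Sum>v\<in>UNIV. Poly_Mapping.lookup n (X v)) < (\<Sum>v\<in>UNIV. Poly_Mapping.lookup m (X v))"
        by (intro sum_strict_mono_ex1) (use i in \<open>auto intro!: exI[of _ i] simp: not_less\<close>)
      with xd show False by simp
    qed
    then obtain j where j: "Poly_Mapping.lookup m (X j) < Poly_Mapping.lookup n (X j)" ..
    with vd[of j] have yj: "Poly_Mapping.lookup n (Y j) < Poly_Mapping.lookup m (Y j)"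
      by linarith
    from i j have ij: "i \<noteq> j" by auto
    define r where "r = m - (xm i + ym j)"
    have m: "m = r + (xm i + ym j)"
      by (rule poly_mapping_eqI)
        (use i yj in \<open>auto simp: r_def lookup_add lookup_minus lookup_single when_def\<close>)
    define m' where "m' = r + (xm j + ym i)"
    have "m' \<in> swap_class m"
      by (simp add: swap_class_def m m'_def degrees_swap[of r i j])
    with less.prems have m': "m' \<in> swap_class n"
      by (simp add: swap_class_def)
    have lk: "Poly_Mapping.lookup m' (X v) = (if v = i then Poly_Mapping.lookup m (X i) - 1 else
        if v = j then Poly_Mapping.lookup m (X j) + 1 else Poly_Mapping.lookup m (X v))" for v
      using ij by (auto simp: m m'_def lookup_add lookup_single when_def)
    have "(\<Sum>v\<in>UNIV. Poly_Mapping.lookup m' (X v) - Poly_Mapping.lookup n (X v)) <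
        (\<Sum>v\<in>UNIV. Poly_Mapping.lookup m (X v) - Poly_Mapping.lookup n (X v))"
      by (rule sum_strict_mono_ex1) (use i j in \<open>auto simp: lk intro!: exI[of _ i]\<close>)
    from less.hyps[OF this m']
    have "Poly_Mapping.single m' 1 - Poly_Mapping.single n 1 \<in> ideal_generated B" .
    moreover have "Poly_Mapping.single r 1 * edge_binomial i j \<in> ideal_generated B"
      by (rule ideal_generated_mult[OF B])
    moreover have "Poly_Mapping.single r 1 * edge_binomial i j =
        (Poly_Mapping.single m 1 - Poly_Mapping.single m' 1 :: ('v, 'k) S)"
      by (simp add: edge_binomial_eq right_diff_distrib mult_single m m'_def)
    ultimately show ?thesis
      using ideal_generated_add[of "Poly_Mapping.single m 1 - Poly_Mapping.single m' 1" B
          "Poly_Mapping.single m' 1 - Poly_Mapping.single n 1"]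
      by simp
  qed
qed

text \<open>Replacing each monomial by a fixed representative of its swap class changes the
  polynomial by an element of the ideal, and collects in front of each representative exactly the
  coefficient sum of its class.\<close>

lemma in_ideal_of_coeff_sum_zero:
  fixes g :: "('v::finite, 'k::comm_ring_1) S"
  assumes B: "\<And>i j. edge_binomial i j \<in> ideal_generated B"
    and zero: "\<And>m. coeff_sum (swap_class m) g = 0"
  shows "g \<in> ideal_generated B"
proof -
  let ?K = "Poly_Mapping.keys g"
  define rep :: "'v monomial set \<Rightarrow> 'v monomial" where "rep C = (SOME n. n \<in> C)" for C
  have rep: "m \<in> swap_class (rep (swap_class m))" for m :: "'v monomial"
  proof -
    have "m \<in> swap_class m" by (simp add: swap_class_def)
    then have "rep (swap_class m) \<in> swap_class m"
      unfolding rep_def by (rule someI)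
    then show ?thesis by (simp add: swap_class_def)
  qed
  have zero': "(\<Sum>m\<in>?K. Poly_Mapping.single (rep (swap_class m)) (Poly_Mapping.lookup g m)) = 0"
  proof -
    have "(\<Sum>m\<in>?K. Poly_Mapping.single (rep (swap_class m)) (Poly_Mapping.lookup g m)) =
      (\<Sum>C\<in>swap_class ` ?K. \<Sum>m\<in>{m\<in>?K. swap_class m = C}.
        Poly_Mapping.single (rep (swap_class m)) (Poly_Mapping.lookup g m))"
      by (rule sum.image_gen) simp
    also have "\<dots> = 0"
    proof (rule sum.neutral, safe)
      fix k assume "k \<in> ?K"
      have "(\<Sum>m\<in>{m\<in>?K. swap_class m = swap_class k}. Poly_Mapping.lookup g m) =
          coeff_sum (swap_class k) g"
        by (simp add: coeff_sum_def swap_class_eq_iff sum.inter_filter)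
      then have s: "(\<Sum>m\<in>{m\<in>?K. swap_class m = swap_class k}. Poly_Mapping.lookup g m) = 0"
        by (simp add: zero)
      have "(\<Sum>m\<in>{m\<in>?K. swap_class m = swap_class k}.
            Poly_Mapping.single (rep (swap_class m)) (Poly_Mapping.lookup g m)) =
          Poly_Mapping.single (rep (swap_class k))
            (\<Sum>m\<in>{m\<in>?K. swap_class m = swap_class k}. Poly_Mapping.lookup g m)"
        by (rule poly_mapping_eqI) (simp add: lookup_sum lookup_single when_def)
      with s show "(\<Sum>m\<in>{m\<in>?K. swap_class m = swap_class k}.
            Poly_Mapping.single (rep (swap_class m)) (Poly_Mapping.lookup g m)) = 0"
        by simp
    qed
    finally show ?thesis .
  qed
  have "Poly_Mapping.single 0 (Poly_Mapping.lookup g m) * (Poly_Mapping.single m 1 -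
      Poly_Mapping.single (rep (swap_class m)) 1) \<in> ideal_generated B" for m
    by (intro ideal_generated_mult swap_class_cong_ideal B rep)
  then have "(\<Sum>m\<in>?K. Poly_Mapping.single m (Poly_Mapping.lookup g m) -
      Poly_Mapping.single (rep (swap_class m)) (Poly_Mapping.lookup g m)) \<in> ideal_generated B"
    by (intro ideal_generated_sum) (simp add: right_diff_distrib mult_single)
  then show ?thesis
    using poly_mapping_expand[of g] by (simp add: sum_subtractf zero')
qed

lemma edge_binomial_in_ideal_generated:
  fixes B :: "('v::linorder, 'k::comm_ring_1) S set"
  assumes "i < j \<Longrightarrow> edge_binomial i j \<in> B" and "j < i \<Longrightarrow> edge_binomial j i \<in> B"
  shows "edge_binomial i j \<in> ideal_generated B"
proof (cases i j rule: linorder_cases)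
  case greater
  with assms show ?thesis
    by (subst edge_binomial_swap) (intro ideal_generated_uminus ideal_generated_base)
qed (use assms in \<open>auto simp: edge_binomial_same ideal_generated_zero intro: ideal_generated_base\<close>)

lemma edge_binomial_in_P_empty:
  assumes "connected_graph E"
  shows "edge_binomial i j \<in> P_empty E"
  unfolding P_empty_def using assms
  by (intro edge_binomial_in_ideal_generated) (auto simp: connected_graph_def)

lemma edge_binomial_in_binomial_edge_ideal:
  assumes "{i, j} \<in> E"
  shows "edge_binomial i j \<in> binomial_edge_ideal E"
proof -
  have "{j, i} \<in> E"
    using assms by (simp add: insert_commute)
  with assms show ?thesis
    unfolding binomial_edge_ideal_def
    by (intro edge_binomial_in_ideal_generated) blast+
qed

lemma binomial_edge_ideal_subset_P_empty: "binomial_edge_ideal E \<subseteq> P_empty E"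
  unfolding binomial_edge_ideal_def P_empty_def same_component_def
  by (rule ideal_generated_mono) auto

lemma P_empty_iff_coeff_sum:
  fixes E :: "'v::{finite, linorder} set set"
  assumes "connected_graph E"
  shows "g \<in> P_empty E \<longleftrightarrow> (\<forall>m. coeff_sum (swap_class m) g = 0)"
proof
  assume g: "g \<in> P_empty E"
  show "\<forall>m. coeff_sum (swap_class m) g = 0"
  proof
    fix m
    show "coeff_sum (swap_class m) g = 0"
    proof (rule coeff_sum_ideal_generated[OF g[unfolded P_empty_def]], safe)
      fix n and i j :: 'v
      have "n + (xm i + ym j) \<in> swap_class m \<longleftrightarrow> n + (xm j + ym i) \<in> swap_class m"
        by (simp add: swap_class_def degrees_swap[of n i j])
      then show "coeff_sum (swap_class m) (Poly_Mapping.single n 1 * edge_binomial i j) = 0"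
        by (simp add: coeff_sum_edge_binomial)
    qed
  qed
next
  assume "\<forall>m. coeff_sum (swap_class m) g = 0"
  then show "g \<in> P_empty E"
    using in_ideal_of_coeff_sum_zero edge_binomial_in_P_empty[OF assms]
    unfolding P_empty_def by blast
qed

lemma single_not_in_P_empty:
  fixes E :: "'v::{finite, linorder} set set"
  assumes "connected_graph E"
  shows "(Poly_Mapping.single w 1 :: ('v, 'k::field) S) \<notin> P_empty E"
  using assms by (auto simp: P_empty_iff_coeff_sum swap_class_def intro!: exI[of _ w])

text \<open>Multiplication by a monomial translates each swap class injectively into another one, so
  it only permutes the conditions that describe the ideal.\<close>

lemma P_empty_cancel_single:
  fixes E :: "'v::{finite, linorder} set set" and g :: "('v, 'k::field) S"
  assumes E: "connected_graph E" and g: "Poly_Mapping.single w 1 * g \<in> P_empty E"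
  shows "g \<in> P_empty E"
proof -
  have "coeff_sum (swap_class m) g = 0" for m
  proof -
    have "coeff_sum (swap_class (w + m)) (Poly_Mapping.single w 1 * g) = 0"
      using g P_empty_iff_coeff_sum[OF E] by blast
    then show ?thesis
      by (simp add: coeff_sum_single_times swap_class_add_iff)
  qed
  then show ?thesis
    using P_empty_iff_coeff_sum[OF E] by blast
qed


section \<open>A monomial whose colon ideal is the generic determinantal ideal\<close>

text \<open>Along a path, the identity \<open>x\<^sub>j f\<^sub>i\<^sub>k = x\<^sub>i f\<^sub>j\<^sub>k + x\<^sub>k f\<^sub>i\<^sub>j\<close> extends the path by the edge
  \<open>{j, k}\<close> at the price of the factor \<open>x\<^sub>j\<close>.\<close>

lemma monomial_times_edge_binomial:
  fixes E :: "'v::{finite, linorder} set set"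
  assumes "same_component E i j"
  shows "\<exists>w. Poly_Mapping.single w 1 * edge_binomial i j \<in>
    (binomial_edge_ideal E :: ('v, 'k::field) S set)"
  using assms unfolding same_component_def
proof (induction rule: rtranclp_induct)
  case base
  show ?case
    by (simp add: edge_binomial_same binomial_edge_ideal_def ideal_generated_zero)
next
  case (step j k)
  then obtain w where
    w: "Poly_Mapping.single w 1 * edge_binomial i j \<in> (binomial_edge_ideal E :: ('v, 'k) S set)"
    by blast
  let ?w = "Poly_Mapping.single w 1 :: ('v, 'k) S"
  have "?w * var (X i) * edge_binomial j k + var (X k) * (?w * edge_binomial i j)
      \<in> binomial_edge_ideal E"
    using ideal_generated_mult[OF edge_binomial_in_binomial_edge_ideal
        [OF step(2), unfolded binomial_edge_ideal_def]] w
    unfolding binomial_edge_ideal_def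
    by (intro ideal_generated_add) (assumption | rule ideal_generated_mult)+
  also have "?w * var (X i) * edge_binomial j k + var (X k) * (?w * edge_binomial i j) =
      (?w * var (X j)) * edge_binomial i k"
    by (simp add: edge_binomial_def algebra_simps)
  finally have "Poly_Mapping.single (w + xm j) 1 * edge_binomial i k
      \<in> (binomial_edge_ideal E :: ('v, 'k) S set)"
    by (simp add: var_def mult_single)
  then show ?case by blast
qed

text \<open>The product over all pairs of vertices of the monomials from
  \<open>monomial_times_edge_binomial\<close> works for all pairs at once.\<close>

lemma exists_monomial_colon_eq_P_empty:
  fixes E :: "'v::{finite, linorder} set set"
  assumes E: "connected_graph E"
  shows "\<exists>w. colon (binomial_edge_ideal E) (Poly_Mapping.single w 1) =
    (P_empty E :: ('v, 'k::field) S set)"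
proof -
  let ?J = "binomial_edge_ideal E :: ('v, 'k) S set"
  have "\<forall>p. \<exists>w. Poly_Mapping.single w 1 * edge_binomial (fst p) (snd p) \<in> ?J"
    using E by (auto simp: connected_graph_def intro: monomial_times_edge_binomial)
  then obtain w where w: "\<And>p. Poly_Mapping.single (w p) 1 * edge_binomial (fst p) (snd p) \<in> ?J"
    by metis
  define W where "W = (\<Sum>p\<in>(UNIV :: ('v \<times> 'v) set). w p)"
  have W: "edge_binomial i j * Poly_Mapping.single W 1 \<in> ?J" for i j
  proof -
    have W': "W = (\<Sum>p\<in>UNIV - {(i, j)}. w p) + w (i, j)"
      unfolding W_def by (subst sum.remove[of _ "(i, j)"]) (auto simp: add.commute)
    have "Poly_Mapping.single (\<Sum>p\<in>UNIV - {(i, j)}. w p) 1 *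
        (Poly_Mapping.single (w (i, j)) 1 * edge_binomial i j) \<in> ?J"
      using w[of "(i, j)"] unfolding binomial_edge_ideal_def fst_conv snd_conv
      by (rule ideal_generated_mult)
    then show ?thesis
      by (simp add: W' mult.assoc[symmetric] mult_single) (simp add: mult.commute)
  qed
  have "g \<in> P_empty E" if "g * Poly_Mapping.single W 1 \<in> ?J" for g
  proof -
    have "Poly_Mapping.single W 1 * g \<in> P_empty E"
      using that binomial_edge_ideal_subset_P_empty[of E] by (auto simp: mult.commute)
    then show ?thesis by (rule P_empty_cancel_single[OF E])
  qed
  moreover have "g * Poly_Mapping.single W 1 \<in> ?J" if "g \<in> P_empty E" for g
    using that unfolding P_empty_def
  proof (induction rule: ideal_generated_induct)
    case zero
    show ?case by (simp add: binomial_edge_ideal_def ideal_generated_zero)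
  next
    case (step c x y)
    then have "x * Poly_Mapping.single W 1 \<in> ?J"
      using W by auto
    with step(2) have "c * (x * Poly_Mapping.single W 1) + y * Poly_Mapping.single W 1 \<in> ?J"
      unfolding binomial_edge_ideal_def
      using ideal_generated_add ideal_generated_mult by blast
    then show ?case by (simp add: algebra_simps)
  qed
  ultimately have "colon ?J (Poly_Mapping.single W 1) = P_empty E"
    by (auto simp: colon_def)
  then show ?thesis by blast
qed

text \<open>Whether \<open>f * w\<close> lies in the binomial edge ideal is symmetric in \<open>f\<close> and \<open>w\<close>. Taking for
  \<open>w\<close> the monomial of the previous lemma, \<open>f \<in> P_empty E\<close> would give \<open>w \<in> P_empty E\<close>.\<close>

lemma not_in_P_empty_if_colon_eq:
  fixes E :: "'v::{finite, linorder} set set" and f :: "('v, 'k::field) S"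
  assumes E: "connected_graph E" and f: "colon (binomial_edge_ideal E) f = P_empty E"
  shows "f \<notin> P_empty E"
proof
  assume fP: "f \<in> P_empty E"
  obtain w where w: "colon (binomial_edge_ideal E) (Poly_Mapping.single w 1) =
      (P_empty E :: ('v, 'k) S set)"
    using exists_monomial_colon_eq_P_empty[OF E] by blast
  with fP have "f * Poly_Mapping.single w 1 \<in> binomial_edge_ideal E"
    by (auto simp: colon_def)
  then have "Poly_Mapping.single w 1 \<in> colon (binomial_edge_ideal E) f"
    by (simp add: colon_def mult.commute)
  with f single_not_in_P_empty[OF E] show False by blast
qed


section \<open>Supports are dominating\<close>

text \<open>The two terms of a monomial multiple of \<open>f\<^sub>a\<^sub>b\<close> have the same vertex degrees and the same
  \<open>x\<close>-degree; they can differ in their exponent of \<open>Y v\<close> only if \<open>v\<close> is an endpoint of the edge.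
  In that case neither of them has vertex degrees \<open>c\<close>, since \<open>c\<close> vanishes at the other
  endpoint.\<close>

lemma coeff_sum_binomial_edge_ideal_zero:
  fixes E :: "'v::{finite, linorder} set set" and g :: "('v, 'k::field) S"
  assumes c: "\<And>u. {u, v} \<in> E \<Longrightarrow> c u = 0"
    and E: "simple_graph E"
    and g: "g \<in> binomial_edge_ideal E"
  shows "coeff_sum {n. vertex_degree n = c \<and> x_degree n = k \<and> Poly_Mapping.lookup n (Y v) = 0} g = 0"
    (is "coeff_sum ?A g = 0")
proof (rule coeff_sum_ideal_generated[OF g[unfolded binomial_edge_ideal_def]], safe)
  fix n and a b :: 'v
  assume ab: "{a, b} \<in> E"
  have "n + (xm a + ym b) \<in> ?A \<longleftrightarrow> n + (xm b + ym a) \<in> ?A"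
  proof (cases "v \<in> {a, b}")
    case True
    then have "c a = 0 \<or> c b = 0"
      using c[of a] c[of b] ab by (auto simp: insert_commute)
    moreover have "c a > 0 \<and> c b > 0" if "n + (xm a + ym b) \<in> ?A \<or> n + (xm b + ym a) \<in> ?A"
      using that by (auto simp: degree_simps)
    ultimately show ?thesis by auto
  next
    case False
    then show ?thesis
      by (auto simp: degrees_swap[of n a b] lookup_add lookup_single when_def)
  qed
  then show "coeff_sum ?A (Poly_Mapping.single n 1 * edge_binomial a b) = 0"
    by (simp add: coeff_sum_edge_binomial)
qed

text \<open>If \<open>v\<close> is not dominated, multiplication by \<open>f\<^sub>v\<^sub>j\<close> with \<open>j\<close> not adjacent to \<open>v\<close> leaves the
  coefficient sum of \<open>f\<close> visible to a functional that vanishes on the binomial edge ideal. The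
  condition that \<open>Y v\<close> does not occur separates the two terms \<open>x\<^sub>v y\<^sub>j\<close> and \<open>x\<^sub>j y\<^sub>v\<close> of \<open>f\<^sub>v\<^sub>j\<close>,
  which would otherwise cancel.\<close>

lemma support_dominating:
  fixes E :: "'v::{finite, linorder} set set" and f :: "('v, 'k::field) S"
  assumes E: "simple_graph E" "\<not> complete_graph E"
    and f: "\<And>i j. f * edge_binomial i j \<in> binomial_edge_ideal E"
    and m: "coeff_sum (swap_class m) f \<noteq> 0"
  shows "dominating_set E {v. vertex_degree m v \<noteq> 0}"
proof (rule ccontr)
  assume nd: "\<not> ?thesis"
  have "\<exists>v j. v \<noteq> j \<and> {j, v} \<notin> E \<and> vertex_degree m v = 0 \<and>
      (\<forall>u. {u, v} \<in> E \<longrightarrow> vertex_degree m u = 0)"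
    (* An empty support dominates nothing; only then does j have to come from a missing edge. *)
  proof (cases "\<exists>j. vertex_degree m j \<noteq> 0")
    case True
    then obtain j where j: "vertex_degree m j \<noteq> 0" ..
    from nd obtain v where v: "vertex_degree m v = 0"
      and nb: "\<And>u. {u, v} \<in> E \<Longrightarrow> vertex_degree m u = 0"
      by (auto simp: dominating_set_def)
    from j v nb[of j] have "v \<noteq> j" "{j, v} \<notin> E"
      by auto
    with v nb show ?thesis
      by blast
  next
    case False
    with E(2) show ?thesis
      by (auto simp: complete_graph_def insert_commute)
  qed
  then obtain v j where vj: "v \<noteq> j" "{j, v} \<notin> E" "vertex_degree m v = 0"
    and nb: "\<And>u. {u, v} \<in> E \<Longrightarrow> vertex_degree m u = 0"
    by blast
  have loop: "{v, v} \<notin> E"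
    using E(1) by (auto simp: simple_graph_def)
  define A where "A = {n. vertex_degree n = vertex_degree (m + (xm v + ym j)) \<and>
    x_degree n = x_degree (m + (xm v + ym j)) \<and> Poly_Mapping.lookup n (Y v) = 0}"
  have "coeff_sum A (f * edge_binomial v j) = 0"
    unfolding A_def
    by (rule coeff_sum_binomial_edge_ideal_zero[OF _ E(1) f])
      (use nb vj loop in \<open>auto simp: degree_simps\<close>)
  moreover have "coeff_sum A (f * edge_binomial v j) = coeff_sum (swap_class m) f"
  proof -
    have "Poly_Mapping.lookup n (Y v) = 0" if "vertex_degree n = vertex_degree m" for n
      using vj(3) fun_cong[OF that, of v] by (simp add: vertex_degree_def)
    then have "{n. (xm v + ym j) + n \<in> A} = swap_class m"
      using vj(1) by (auto simp: A_def swap_class_def degree_simps fun_eq_iff lookup_add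
          lookup_single when_def)
    moreover have "{n. (xm j + ym v) + n \<in> A} = {}"
      by (auto simp: A_def lookup_add lookup_single)
    moreover have "coeff_sum {} f = 0"
      by (simp add: coeff_sum_def)
    moreover have "f * edge_binomial v j =
        Poly_Mapping.single (xm v + ym j) 1 * f - Poly_Mapping.single (xm j + ym v) 1 * f"
      by (simp add: edge_binomial_eq algebra_simps)
    ultimately show ?thesis
      by (simp add: coeff_sum_diff coeff_sum_single_times)
  qed
  ultimately show False
    using m by simp
qed

theorem corollary3p9:
  fixes E :: "'v::{finite, linorder} set set"
  assumes "simple_graph E"
    and "connected_graph E"
    and "\<not> complete_graph E"
  shows "domination_number E \<le> v_empty TYPE('k::field) E"
proof -
  let ?P = "\<lambda>d. \<exists>f \<in> homogeneous_part d.
    colon (binomial_edge_ideal E) f = (P_empty E :: ('v, 'k) S set)"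
  obtain w where "colon (binomial_edge_ideal E) (Poly_Mapping.single w 1) =
      (P_empty E :: ('v, 'k) S set)"
    using exists_monomial_colon_eq_P_empty[OF assms(2)] by blast
  moreover have "Poly_Mapping.single w 1 \<in> homogeneous_part (monomial_degree w)"
    by (simp add: homogeneous_part_def)
  (* Without a witness, LEAST would be an arbitrary number. *)
  ultimately have "?P (monomial_degree w)"
    by blast
  then have "?P (v_empty TYPE('k) E)"
    unfolding v_empty_def by (rule LeastI)
  then obtain f :: "('v, 'k) S" where hom: "f \<in> homogeneous_part (v_empty TYPE('k) E)"
    and f: "colon (binomial_edge_ideal E) f = P_empty E"
    by blast
  have "f \<notin> P_empty E"
    by (rule not_in_P_empty_if_colon_eq[OF assms(2) f])
  then obtain m where m: "coeff_sum (swap_class m) f \<noteq> 0"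
    using P_empty_iff_coeff_sum[OF assms(2)] by blast
  then obtain n where n: "n \<in> Poly_Mapping.keys f" "n \<in> swap_class m"
    unfolding coeff_sum_def by (auto elim!: sum.not_neutral_contains_not_neutral split: if_splits)
  have "f * edge_binomial i j \<in> binomial_edge_ideal E" for i j
    using edge_binomial_in_P_empty[OF assms(2), of i j] f
    by (auto simp: colon_def mult.commute)
  then have "dominating_set E {v. vertex_degree m v \<noteq> 0}"
    by (rule support_dominating[OF assms(1,3) _ m])
  then have "domination_number E \<le> card {v. vertex_degree m v \<noteq> 0}"
    unfolding domination_number_def by (intro Min_le) auto
  also have "\<dots> = card {v. vertex_degree n v \<noteq> 0}"
    using n(2) by (simp add: swap_class_def)
  also have "\<dots> \<le> monomial_degree n"
    by (rule card_support_le_monomial_degree)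
  also have "\<dots> = v_empty TYPE('k) E"
    using hom n(1) by (auto simp: homogeneous_part_def)
  finally show ?thesis .
qed

end
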